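(* Let $G$ be an almost bipartite non-König-Egerváry graph, and let $C$ be its unique odd cycle. Then every maximum matching of $G$ contains $\left\lfloor \frac{|V(C)|}{2}\right\rfloor$ edges belonging to $C$. Moreover, every maximum matching of $G[V(C)]$ may be enlarged to a maximum matching of $G$ that saturates all the vertices of $C$ but one.
   Context: All graphs are finite, undirected, loopless, without multiple edges; $G=(V(G),E(G))$ and $n(G)=|V(G)|$. $G[X]$ is the subgraph induced by $X\subseteq V(G)$. $\alpha(G)$ is the maximum size of an independent set and $\mu(G)$ the maximum size of a matching. $G$ is a König-Egerváry graph if $\alpha(G)+\mu(G)=n(G)$. $G$ is almost bipartite if it has exactly one odd cycle. A matching $M$ saturates a vertex $v$ if some edge of $M$ is incident with $v$. *)

theory Defs
  imports Main "HOL-Library.Ramsey"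
begin

record 'a ugraph =
  verts :: "'a set"
  edges :: "'a set set"

text \<open>Edges are two-element sets of vertices, so there are no loops and no multiple edges.\<close>

definition fin_simple_graph :: "'a ugraph \<Rightarrow> bool" where
  "fin_simple_graph G \<longleftrightarrow> finite (verts G) \<and> edges G \<subseteq> nsets (verts G) 2"

definition subgraph :: "'a ugraph \<Rightarrow> 'a ugraph \<Rightarrow> bool" where
  "subgraph H G \<longleftrightarrow> verts H \<subseteq> verts G \<and> edges H \<subseteq> edges G"

definition induced :: "'a ugraph \<Rightarrow> 'a set \<Rightarrow> 'a ugraph" where
  "induced G X = \<lparr>verts = X, edges = {e \<in> edges G. e \<subseteq> X}\<rparr>"

definition independent_set :: "'a ugraph \<Rightarrow> 'a set \<Rightarrow> bool" where
  "independent_set G S \<longleftrightarrow> S \<subseteq> verts G \<and> indep S (edges G)"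

definition independence_number :: "'a ugraph \<Rightarrow> nat" where
  "independence_number G = Max (card ` {S. independent_set G S})"

definition matching :: "'a ugraph \<Rightarrow> 'a set set \<Rightarrow> bool" where
  "matching G M \<longleftrightarrow> M \<subseteq> edges G \<and> pairwise disjnt M"

definition matching_number :: "'a ugraph \<Rightarrow> nat" where
  "matching_number G = Max (card ` {M. matching G M})"

definition maximum_matching :: "'a ugraph \<Rightarrow> 'a set set \<Rightarrow> bool" where
  "maximum_matching G M \<longleftrightarrow> matching G M \<and> card M = matching_number G"

definition saturates :: "'a set set \<Rightarrow> 'a \<Rightarrow> bool" where
  "saturates M v \<longleftrightarrow> (\<exists>e\<in>M. v \<in> e)"

definition Koenig_Egervary :: "'a ugraph \<Rightarrow> bool" where
  "Koenig_Egervary G \<longleftrightarrow>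
     independence_number G + matching_number G = card (verts G)"

text \<open>A cycle is a graph (to be considered as a subgraph), not a closed walk: traversals of the
  same cycle that differ in starting vertex or orientation give the same graph.\<close>

definition is_cycle :: "'a ugraph \<Rightarrow> bool" where
  "is_cycle C \<longleftrightarrow> (\<exists>xs. length xs \<ge> 3 \<and> distinct xs \<and> verts C = set xs \<and>
     edges C = {{xs ! i, xs ! (Suc i mod length xs)} | i. i < length xs})"

definition odd_cycle_of :: "'a ugraph \<Rightarrow> 'a ugraph \<Rightarrow> bool" where
  "odd_cycle_of G C \<longleftrightarrow> subgraph C G \<and> is_cycle C \<and> odd (card (verts C))"

definition almost_bipartite :: "'a ugraph \<Rightarrow> bool" where
  "almost_bipartite G \<longleftrightarrow> (\<exists>!C. odd_cycle_of G C)"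

end

theory Submission
  imports Defs
begin

text \<open>Write \<open>H\<close> for \<open>G\<close> with the edges of the odd cycle \<open>C\<close> removed, and let \<open>2k + 1\<close> be the length of
  \<open>C\<close>.  A matching of \<open>G\<close> is a matching of \<open>H\<close> together with at most \<open>k\<close> edges of \<open>C\<close>, so it has at
  most \<open>k + \<mu>(H)\<close> edges.  The theorem follows once \<open>H\<close> is known to have a maximum matching \<open>M'\<close>
  that misses all of \<open>V(C)\<close> (\<open>matching_avoiding_cycle\<close>): every matching \<open>M\<^sub>0\<close> of \<open>G[V(C)]\<close> with \<open>k\<close>
  edges is then compatible with \<open>M'\<close>, so the bound is attained by \<open>M\<^sub>0 \<union> M'\<close>, every maximum matching
  must use \<open>k\<close> edges of \<open>C\<close>, and \<open>M\<^sub>0 \<union> M'\<close> leaves exactly one vertex of \<open>C\<close> unsaturated.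

  Two facts produce \<open>M'\<close>.  First, distinct vertices of \<open>C\<close> lie in distinct components of \<open>H\<close>
  (\<open>component_meets_cycle_once\<close>): a connection in \<open>H\<close> would close up with one of the two arcs of
  \<open>C\<close>, whose lengths have different parity, to a second odd cycle.  So \<open>H\<close> can be treated one
  component at a time.  Second, the component \<open>K\<close> of \<open>v \<in> V(C)\<close> has a maximum matching that misses
  \<open>v\<close> (\<open>component_matching_missing_attachment\<close>).  Otherwise deleting \<open>v\<close> lowers the matching number
  of the bipartite graph \<open>H[K]\<close>, and Koenig's theorem gives a minimum vertex cover of \<open>H[K]\<close> that
  contains \<open>v\<close>.  As \<open>G - K\<close> is bipartite too, it has a vertex cover and a matching of equal size.
  Every edge between \<open>K\<close> and the rest is an edge of \<open>C\<close> at \<open>v\<close>, so the two covers together cover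
  \<open>G\<close> with as many vertices as the two matchings have edges, and \<open>G\<close> would be Koenig-Egervary.

  Bipartiteness enters as two-colourability (\<open>two_colouring\<close>), in the proof of Koenig's theorem
  (\<open>koenig\<close>) as well as in the parity argument about the two arcs.\<close>

section \<open>Components and two-colourings\<close>

definition proper_colouring :: "('a \<Rightarrow> bool) \<Rightarrow> 'a set set \<Rightarrow> bool" where
  "proper_colouring c E \<longleftrightarrow> (\<forall>x y. {x, y} \<in> E \<longrightarrow> c x \<noteq> c y)"

definition vertex_cover :: "'a set \<Rightarrow> 'a set set \<Rightarrow> bool" where
  "vertex_cover X E \<longleftrightarrow> finite X \<and> (\<forall>e\<in>E. e \<inter> X \<noteq> {})"

definition component :: "'a set set \<Rightarrow> 'a \<Rightarrow> 'a set" where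
  "component E v = {w. (v, w) \<in> {(x, y). {x, y} \<in> E}\<^sup>*}"

lemma proper_colouring_mono: "proper_colouring c E \<Longrightarrow> F \<subseteq> E \<Longrightarrow> proper_colouring c F"
  unfolding proper_colouring_def by blast

lemma self_in_component: "v \<in> component E v"
  unfolding component_def by simp

lemma component_closed:
  assumes "{x, y} \<in> E" "x \<in> component E v"
  shows "y \<in> component E v"
  using assms unfolding component_def by (auto intro: rtrancl_into_rtrancl)

lemma edge_in_component:
  assumes "card e = 2" "e \<in> E" "e \<inter> component E v \<noteq> {}"
  shows "e \<subseteq> component E v"
proof -
  obtain x y where e: "e = {x, y}" using assms(1) by (auto simp: card_2_iff)
  then have "{x, y} \<in> E" "{y, x} \<in> E" using assms(2) by (auto simp: insert_commute)
  then show ?thesis using e assms(3) component_closed by fastforce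
qed

text \<open>A two-colouring of a connected graph is unique up to exchanging the colours.\<close>

lemma colour_agreement_in_component:
  assumes "proper_colouring c E" "proper_colouring d E" "w \<in> component E v"
  shows "c v = c w \<longleftrightarrow> d v = d w"
proof -
  have "(v, w) \<in> {(x, y). {x, y} \<in> E}\<^sup>*" using assms(3) by (simp add: component_def)
  then show ?thesis
    by induction (use assms(1,2) in \<open>auto simp: proper_colouring_def\<close>)
qed

lemma colour_along_path:
  fixes f :: "nat \<Rightarrow> 'a"
  assumes "proper_colouring c E" "\<And>k. i \<le> k \<Longrightarrow> k < j \<Longrightarrow> {f k, f (Suc k)} \<in> E" "i \<le> j"
  shows "c (f i) = c (f j) \<longleftrightarrow> even (j - i)"
  using assms(3,2)
proof (induction j rule: dec_induct)
  case base
  show ?case by simp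
next
  case (step n)
  have "c (f n) \<noteq> c (f (Suc n))"
    using step.prems[of n] step.hyps assms(1) by (auto simp: proper_colouring_def)
  moreover have "c (f i) = c (f n) \<longleftrightarrow> even (n - i)" using step by simp
  moreover have "Suc n - i = Suc (n - i)" using step.hyps by simp
  ultimately show ?case by (metis even_Suc)
qed

lemma simple_path_in_component:
  assumes "y \<in> component E x"
  obtains p where "p \<noteq> []" "distinct p" "hd p = x" "last p = y"
    "\<And>k. Suc k < length p \<Longrightarrow> {p ! k, p ! Suc k} \<in> E"
proof -
  have "(x, y) \<in> {(x, y). {x, y} \<in> E}\<^sup>*" using assms by (simp add: component_def)
  then have "\<exists>p. p \<noteq> [] \<and> distinct p \<and> hd p = x \<and> last p = y \<and>
    (\<forall>k. Suc k < length p \<longrightarrow> {p ! k, p ! Suc k} \<in> E)"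
  proof induction
    case base
    show ?case by (rule exI[of _ "[x]"]) simp
  next
    case (step y z)
    then obtain p where p: "p \<noteq> []" "distinct p" "hd p = x" "last p = y"
      "\<And>k. Suc k < length p \<Longrightarrow> {p ! k, p ! Suc k} \<in> E" by blast
    show ?case
    proof (cases "z \<in> set p")
      case True
      then obtain i where i: "i < length p" "p ! i = z" by (auto simp: in_set_conv_nth)
      let ?q = "take (Suc i) p"
      have "last ?q = z" using i by (simp add: take_Suc_conv_app_nth)
      moreover have "hd ?q = x" using p by simp
      ultimately show ?thesis using p by (intro exI[of _ ?q]) simp
    next
      case False
      have "{(p @ [z]) ! k, (p @ [z]) ! Suc k} \<in> E" if "Suc k < length (p @ [z])" for k
      proof (cases "Suc k < length p")
        case True
        then show ?thesis using p(5) by (simp add: nth_append)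
      next
        case False
        then have k: "Suc k = length p" using that by simp
        then have "p ! k = y" using p(1,4) by (metis diff_Suc_1 last_conv_nth)
        then show ?thesis using k step.hyps by (simp add: nth_append)
      qed
      then show ?thesis using p False by (intro exI[of _ "p @ [z]"]) simp
    qed
  qed
  then show ?thesis using that by blast
qed

text \<open>Induction on the edges.  A new edge between different components is accommodated by exchanging
  the colours in one of them; inside a component, an edge between equally coloured vertices would
  complete a simple path with an odd number of vertices to an odd cycle.\<close>

lemma two_colouring:
  assumes "fin_simple_graph G" "\<And>D. \<not> odd_cycle_of G D"
  obtains c where "proper_colouring c (edges G)"
proof -
  have fin: "finite (edges G)" and sub: "edges G \<subseteq> nsets (verts G) 2"
    using assms(1) finite_imp_finite_nsets finite_subset
    unfolding fin_simple_graph_def by blast+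
  have "\<exists>c. proper_colouring c (edges G)" using fin subset_refl
  proof (induction rule: finite_subset_induct')
    case empty
    show ?case by (simp add: proper_colouring_def)
  next
    case (insert e E)
    obtain c where c: "proper_colouring c E" using insert.IH by blast
    obtain x y where e: "e = {x, y}" "x \<noteq> y"
      using insert.hyps(2) sub by (auto simp: nsets_def card_2_iff)
    show ?case
    proof (cases "c x = c y")
      case False
      then have "proper_colouring c (insert e E)"
        using c e by (auto simp: proper_colouring_def doubleton_eq_iff)
      then show ?thesis by blast
    next
      case same: True
      have far: "y \<notin> component E x"
      proof
        assume "y \<in> component E x"
        then obtain p where p: "p \<noteq> []" "distinct p" "hd p = x" "last p = y"
          "\<And>k. Suc k < length p \<Longrightarrow> {p ! k, p ! Suc k} \<in> E"
          by (rule simple_path_in_component) blast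
        have ends: "p ! 0 = x" "p ! (length p - 1) = y"
          using p by (auto simp: hd_conv_nth last_conv_nth)
        have "even (length p - 1 - 0)"
          using colour_along_path[OF c, of 0 "length p - 1" "\<lambda>k. p ! k"] p(5) ends same by auto
        moreover have "length p > 1"
          using ends e(2) p(1) by (cases p; cases "tl p") auto
        ultimately have len: "length p \<ge> 3" "odd (length p)"
          by (auto elim!: evenE) (presburger+)?
        define D where "D = \<lparr>verts = set p,
          edges = {{p ! i, p ! (Suc i mod length p)} | i. i < length p}\<rparr>"
        have DE: "edges D \<subseteq> insert e E"
        proof
          fix f assume "f \<in> edges D"
          then obtain i where i: "i < length p" "f = {p ! i, p ! (Suc i mod length p)}"
            by (auto simp: D_def)
          show "f \<in> insert e E"
          proof (cases "Suc i < length p")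
            case True
            then show ?thesis using i p(5) by simp
          next
            case False
            then have "Suc i = length p" using i by simp
            then have "f = e" using i ends e by (metis diff_Suc_1 insert_commute mod_self)
            then show ?thesis by simp
          qed
        qed
        have "set p \<subseteq> verts G"
        proof
          fix z assume "z \<in> set p"
          then obtain i where "i < length p" "z = p ! i" by (auto simp: in_set_conv_nth)
          then have "{z, p ! (Suc i mod length p)} \<in> edges D" by (auto simp: D_def)
          then have "{z, p ! (Suc i mod length p)} \<in> nsets (verts G) 2"
            using DE insert.hyps(2,3) sub by blast
          then show "z \<in> verts G" by (simp add: nsets_def)
        qed
        then have "odd_cycle_of G D"
          using DE insert.hyps(2,3) len p(2)
          unfolding odd_cycle_of_def subgraph_def is_cycle_def
          by (auto simp: D_def distinct_card intro!: exI[of _ p])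
        then show False using assms(2) by blast
      qed
      define d where "d w = (if w \<in> component E x then \<not> c w else c w)" for w
      have "d a \<noteq> d b" if "{a, b} \<in> E" for a b
      proof -
        have "a \<in> component E x \<longleftrightarrow> b \<in> component E x"
          using that component_closed by (metis insert_commute)
        then show ?thesis using that c by (auto simp: d_def proper_colouring_def)
      qed
      moreover have "d x \<noteq> d y"
        using same far self_in_component by (auto simp: d_def)
      ultimately have "proper_colouring d (insert e E)"
        unfolding proper_colouring_def e by (auto simp: doubleton_eq_iff)
      then show ?thesis by blast
    qed
  qed
  then show ?thesis using that by blast
qed

section \<open>Koenig's theorem\<close>

lemma pairwise_disjnt_add_edge:
  assumes "pairwise disjnt M" "e \<inter> \<Union>M = {}"
  shows "pairwise disjnt (insert e M)"
  using assms unfolding pairwise_insert disjnt_def by blast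

lemma card_add_edge:
  assumes "finite M" "e \<inter> \<Union>M = {}" "e \<noteq> {}"
  shows "card (insert e M) = Suc (card M)"
  using assms by (subst card_insert_disjoint) auto

lemma Union_remove_edge:
  assumes "pairwise disjnt M" "e \<in> M"
  shows "\<Union>(M - {e}) \<inter> e = {}"
  using assms unfolding pairwise_def disjnt_def by blast

text \<open>The heart of Koenig's theorem: if \<open>u\<close> and \<open>v\<close> on different sides can each be missed by a maximum
  matching, then both can be missed at once.  The usual argument exchanges the two matchings along
  an alternating path that starts in \<open>v\<close>; here its first two edges, \<open>va \<in> M\<close> and \<open>ab \<in> N\<close>, are
  peeled off, which leaves the same situation for \<open>u\<close> and \<open>b\<close> in the graph without \<open>v\<close> and \<open>a\<close>,
  with matching number one less.  Adding \<open>ab\<close> to the matching found there misses \<open>u\<close> and \<open>v\<close>.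
  The colouring excludes the case \<open>b = u\<close>.\<close>

lemma maximum_matchings_exchange:
  assumes "finite E" "\<forall>e\<in>E. card e = 2" "proper_colouring c E" "c u \<noteq> c v"
    and "\<And>L. L \<subseteq> E \<Longrightarrow> pairwise disjnt L \<Longrightarrow> card L \<le> n"
    and "M \<subseteq> E" "pairwise disjnt M" "card M = n" "u \<notin> \<Union>M"
    and "N \<subseteq> E" "pairwise disjnt N" "card N = n" "v \<notin> \<Union>N"
  shows "\<exists>L\<subseteq>E. pairwise disjnt L \<and> card L = n \<and> u \<notin> \<Union>L \<and> v \<notin> \<Union>L"
  using assms
proof (induction n arbitrary: E M N v)
  case 0
  show ?case by (intro exI[of _ "{}"]) simp
next
  case (Suc n)
  note prems = Suc.prems
  have finM: "finite M" and finN: "finite N" using prems finite_subset by blast+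
  show ?case
  proof (cases "v \<in> \<Union>M")
    case False
    then show ?thesis using prems by blast
  next
    case True
    then obtain e where e: "e \<in> M" "v \<in> e" by blast
    then obtain a where a: "e = {v, a}" "a \<noteq> v"
      using prems(2,6) by (metis card_2_iff insertE insert_commute singletonD subsetD)
    \<comment> \<open>Otherwise \<open>va\<close> could be added to \<open>N\<close>.\<close>
    have "a \<in> \<Union>N"
    proof (rule ccontr)
      assume "a \<notin> \<Union>N"
      then have new: "e \<inter> \<Union>N = {}" using prems(13) a by auto
      have "card (insert e N) \<le> Suc n"
        using prems(5,6,10) e pairwise_disjnt_add_edge[OF prems(11) new] by blast
      then show False using card_add_edge[OF finN new] e prems(12) by auto
    qed
    then obtain f where f: "f \<in> N" "a \<in> f" by blast
    then obtain b where b: "f = {a, b}" "b \<noteq> a"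
      using prems(2,10) by (metis card_2_iff insertE insert_commute singletonD subsetD)
    have bv: "b \<noteq> v" using f b prems(13) by auto
    have "c b = c v"
      using e f a b prems(3,6,10) unfolding proper_colouring_def by blast
    then have cb: "c u \<noteq> c b" using prems(4) by simp
    have ua: "u \<noteq> a" using prems(9) e a by auto
    let ?E = "{g \<in> E. g \<inter> e = {}}"
    have M': "M - {e} \<subseteq> ?E" "pairwise disjnt (M - {e})" "card (M - {e}) = n" "u \<notin> \<Union>(M - {e})"
      using Union_remove_edge[OF prems(7) e(1)] prems(6-9) e(1) finM
      by (auto intro: pairwise_subset)
    have N': "N - {f} \<subseteq> ?E" "pairwise disjnt (N - {f})" "card (N - {f}) = n" "b \<notin> \<Union>(N - {f})"
      using Union_remove_edge[OF prems(11) f(1)] prems(10-13) f(1) finN a b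
      by (auto intro: pairwise_subset)
    have "card L \<le> n" if L: "L \<subseteq> ?E" "pairwise disjnt L" for L
    proof -
      have new: "e \<inter> \<Union>L = {}" using L by auto
      have "card (insert e L) \<le> Suc n"
        using prems(5,6) L e pairwise_disjnt_add_edge[OF L(2) new] by blast
      moreover have "finite L" using L prems(1) finite_subset by fastforce
      moreover have "e \<noteq> {}" using e by auto
      ultimately show ?thesis using card_add_edge[OF _ new] by simp
    qed
    then obtain L where L: "L \<subseteq> ?E" "pairwise disjnt L" "card L = n" "u \<notin> \<Union>L" "b \<notin> \<Union>L"
      using Suc.IH[OF _ _ _ cb _ M' N'] prems(1-3) proper_colouring_mono[of c E ?E] by auto
    have new: "f \<inter> \<Union>L = {}" using L a b by auto
    have "finite L" using L(1) prems(1) finite_subset by fastforce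
    then have "card (insert f L) = Suc n" using card_add_edge[OF _ new] f L(3) by auto
    moreover have "pairwise disjnt (insert f L)" by (rule pairwise_disjnt_add_edge[OF L(2) new])
    moreover have "insert f L \<subseteq> E" using L f prems(10) by auto
    moreover have "u \<notin> \<Union>(insert f L)" using L(4) ua b cb by auto
    moreover have "v \<notin> \<Union>(insert f L)" using L(1) a b bv by auto
    ultimately show ?thesis by blast
  qed
qed

lemma maximum_matching_exists:
  assumes "finite E"
  obtains M where "M \<subseteq> E" "pairwise disjnt M"
    "\<And>L. L \<subseteq> E \<Longrightarrow> pairwise disjnt L \<Longrightarrow> card L \<le> card M"
proof -
  have "\<exists>M. (M \<subseteq> E \<and> pairwise disjnt M) \<and>
      (\<forall>L. L \<subseteq> E \<and> pairwise disjnt L \<longrightarrow> card L \<le> card M)"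
    by (rule ex_has_greatest_nat[of _ "{}" card "Suc (card E)"])
       (use assms in \<open>auto simp: card_mono less_Suc_eq_le\<close>)
  then show ?thesis using that by blast
qed

text \<open>One end \<open>w\<close> of any edge is saturated by every maximum matching: otherwise the exchange lemma
  gives a maximum matching missing both ends, and the edge could be added.  Deleting \<open>w\<close> lowers the
  matching number, which pays for putting \<open>w\<close> into the cover (de Caen's argument).\<close>

theorem koenig:
  assumes "finite E" "\<forall>e\<in>E. card e = 2" "proper_colouring c E"
  shows "\<exists>X M. vertex_cover X E \<and> M \<subseteq> E \<and> pairwise disjnt M \<and> card X \<le> card M"
  using assms
proof (induction rule: finite_psubset_induct)
  case (psubset E)
  show ?case
  proof (cases "E = {}")
    case True
    then show ?thesis by (intro exI[of _ "{}"]) (simp add: vertex_cover_def)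
  next
    case False
    then obtain e where e: "e \<in> E" by blast
    then obtain u v where uv: "e = {u, v}" using psubset.prems by (auto simp: card_2_iff)
    obtain M where M: "M \<subseteq> E" "pairwise disjnt M"
      "\<And>L. L \<subseteq> E \<Longrightarrow> pairwise disjnt L \<Longrightarrow> card L \<le> card M"
      using maximum_matching_exists[OF psubset.hyps(1)] by blast
    have "\<exists>w\<in>e. \<forall>L\<subseteq>E. pairwise disjnt L \<and> card L = card M \<longrightarrow> w \<in> \<Union>L"
    proof (rule ccontr)
      assume "\<not> ?thesis"
      then have missed: "\<exists>L\<subseteq>E. pairwise disjnt L \<and> card L = card M \<and> w \<notin> \<Union>L" if "w \<in> e" for w
        using that by auto
      obtain L1 where
        L1: "L1 \<subseteq> E" "pairwise disjnt L1" "card L1 = card M" "u \<notin> \<Union>L1"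
        using missed[of u] uv by auto
      obtain L2 where
        L2: "L2 \<subseteq> E" "pairwise disjnt L2" "card L2 = card M" "v \<notin> \<Union>L2"
        using missed[of v] uv by auto
      have "c u \<noteq> c v" using psubset.prems(2) e uv by (auto simp: proper_colouring_def)
      then obtain L where L: "L \<subseteq> E" "pairwise disjnt L" "card L = card M" "u \<notin> \<Union>L" "v \<notin> \<Union>L"
        using maximum_matchings_exchange[OF psubset.hyps(1) psubset.prems _ M(3) L1 L2] by blast
      then have new: "e \<inter> \<Union>L = {}" using uv by auto
      have "finite L" using L(1) psubset.hyps(1) finite_subset by blast
      then have "card (insert e L) = Suc (card M)" using card_add_edge[OF _ new] uv L(3) by auto
      moreover have "card (insert e L) \<le> card M"
        using M(3) L(1) e pairwise_disjnt_add_edge[OF L(2) new] by blast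
      ultimately show False by simp
    qed
    then obtain w where w: "w \<in> e"
      "\<And>L. L \<subseteq> E \<Longrightarrow> pairwise disjnt L \<Longrightarrow> card L = card M \<Longrightarrow> w \<in> \<Union>L" by blast
    let ?E = "{f \<in> E. w \<notin> f}"
    have "?E \<subset> E" using e w(1) by blast
    moreover have "proper_colouring c ?E"
      using psubset.prems(2) by (rule proper_colouring_mono) auto
    ultimately obtain X L where XL: "vertex_cover X ?E" "L \<subseteq> ?E" "pairwise disjnt L" "card X \<le> card L"
      using psubset.IH[of ?E] psubset.prems(1) by auto
    have "card L \<noteq> card M" using w(2)[of L] XL(2,3) by blast
    then have "card L < card M" using M(3)[of L] XL(2,3) by fastforce
    then have "card (insert w X) \<le> card M" using XL(4) card_insert_le_m1[of "card M" X w] by simp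
    moreover have "vertex_cover (insert w X) E" using XL(1) by (auto simp: vertex_cover_def)
    ultimately show ?thesis using M(1,2) by blast
  qed
qed

section \<open>Matchings and Koenig-Egervary graphs\<close>

lemma card_Union_matching:
  assumes "finite M" "\<forall>e\<in>M. card e = 2" "pairwise disjnt M"
  shows "card (\<Union>M) = 2 * card M"
proof -
  have "card (\<Union>M) = (\<Sum>e\<in>M. card e)"
    by (rule card_Union_disjoint) (use assms card.infinite in \<open>force+\<close>)
  then show ?thesis using assms(2) by simp
qed

text \<open>The complement of the cover is independent, so \<open>\<alpha>(G) + \<mu>(G)\<close> is at least the number of vertices;
  it is never larger, since each edge of a matching has an end outside any given independent
  set.\<close>

lemma koenig_egervary_if_small_cover:
  assumes G: "fin_simple_graph G" and X: "vertex_cover X (edges G)"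
    and M: "matching G M" and le: "card X \<le> card M"
  shows "Koenig_Egervary G"
proof -
  have fV: "finite (verts G)" and sub: "edges G \<subseteq> nsets (verts G) 2"
    using G by (auto simp: fin_simple_graph_def)
  have fE: "finite (edges G)" using fV sub finite_imp_finite_nsets finite_subset by blast
  let ?I = "{S. independent_set G S}" and ?Ms = "{M. matching G M}"
  have fI: "finite (card ` ?I)"
    using fV by (auto simp: independent_set_def intro!: finite_imageI finite_subset[of _ "Pow (verts G)"])
  have fMs: "finite (card ` ?Ms)"
    using fE by (auto simp: matching_def intro!: finite_imageI finite_subset[of _ "Pow (edges G)"])
  have "independent_set G (verts G - X)"
    using X by (auto simp: independent_set_def indep_def vertex_cover_def)
  then have "card (verts G - X) \<le> independence_number G"
    unfolding independence_number_def using fI by (intro Max_ge) auto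
  moreover have "card (verts G) - card X \<le> card (verts G - X)"
    using X by (intro diff_card_le_card_Diff) (simp add: vertex_cover_def)
  moreover have "card M \<le> matching_number G"
    unfolding matching_number_def using fMs M by (intro Max_ge) auto
  ultimately have lower: "card (verts G) \<le> independence_number G + matching_number G"
    using le by linarith
  have "independent_set G {}" by (simp add: independent_set_def indep_def)
  then have "independence_number G \<in> card ` ?I"
    unfolding independence_number_def using fI by (intro Max_in) auto
  then obtain S where S: "independent_set G S" "card S = independence_number G" by auto
  have "matching_number G \<in> card ` ?Ms"
    unfolding matching_number_def using fMs M by (intro Max_in) auto
  then obtain N where N: "matching G N" "card N = matching_number G" by auto
  have "\<exists>x. x \<in> e \<and> x \<in> verts G - S" if "e \<in> N" for e
  proof -
    have "e \<in> edges G" using that N(1) by (auto simp: matching_def)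
    then obtain x y where "e = {x, y}" "x \<noteq> y" "{x, y} \<subseteq> verts G" "{x, y} \<in> edges G"
      using sub by (auto simp: nsets_def card_2_iff)
    then show ?thesis using S(1) unfolding independent_set_def indep_def by blast
  qed
  then obtain h where h: "\<And>e. e \<in> N \<Longrightarrow> h e \<in> e \<and> h e \<in> verts G - S" by metis
  have "inj_on h N"
  proof (rule inj_onI)
    fix e f assume "e \<in> N" "f \<in> N" "h e = h f"
    then show "e = f" using h[of e] h[of f] N(1)
      by (auto simp: matching_def pairwise_def disjnt_def)
  qed
  then have "card N \<le> card (verts G - S)"
    using h fV by (intro card_inj_on_le[of h]) auto
  moreover have "S \<subseteq> verts G" using S(1) by (simp add: independent_set_def)
  ultimately have "independence_number G + matching_number G \<le> card (verts G)"
    using S(2) N(2) fV card_mono[of "verts G" S] by (simp add: card_Diff_subset finite_subset)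
  then show ?thesis using lower by (simp add: Koenig_Egervary_def)
qed


lemma maximum_matching_iff:
  assumes "finite (edges G)"
  shows "maximum_matching G M \<longleftrightarrow>
    matching G M \<and> (\<forall>L. matching G L \<longrightarrow> card L \<le> card M)"
proof -
  have "finite (card ` {M. matching G M})"
    using assms by (auto simp: matching_def intro!: finite_imageI finite_subset[of _ "Pow (edges G)"])
  then show ?thesis
    unfolding maximum_matching_def matching_number_def
    by (auto intro!: Max_eqI[symmetric] simp: Max_ge)
qed

lemma pairwise_disjnt_Un:
  assumes "pairwise disjnt M" "pairwise disjnt N" "\<Union>M \<inter> \<Union>N = {}"
  shows "pairwise disjnt (M \<union> N)"
  using assms unfolding pairwise_def disjnt_def by blast

lemma card_Un_matchings:
  assumes "finite M" "finite N" "\<forall>e\<in>M. card e = 2" "\<Union>M \<inter> \<Union>N = {}"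
  shows "card (M \<union> N) = card M + card N"
proof (rule card_Un_disjoint)
  show "M \<inter> N = {}"
  proof (rule ccontr)
    assume "M \<inter> N \<noteq> {}"
    then obtain e where "e \<in> M" "e \<in> N" by blast
    then have "e = {}" using assms(4) by blast
    then show False using \<open>e \<in> M\<close> assms(3) by auto
  qed
qed (use assms in auto)

section \<open>Cycles\<close>

lemma cycle_edges_distinct:
  assumes "distinct xs" "length xs \<ge> 3" "k < length xs" "l < length xs"
    and "{xs ! k, xs ! (Suc k mod length xs)} = {xs ! l, xs ! (Suc l mod length xs)}"
  shows "k = l"
proof (rule ccontr)
  assume "k \<noteq> l"
  let ?n = "length xs"
  have less: "Suc k mod ?n < ?n" "Suc l mod ?n < ?n" using assms(2) by (auto intro: mod_less_divisor)
  have "k = Suc l mod ?n" "Suc k mod ?n = l"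
    using assms(5) \<open>k \<noteq> l\<close> less assms(1,3,4)
    by (auto simp: doubleton_eq_iff nth_eq_iff_index_eq)
  then show False
    using assms(2-4) by (auto simp: mod_Suc split: if_splits)
qed

lemma cycle_edge_subset:
  assumes "is_cycle C" "e \<in> edges C"
  shows "e \<subseteq> verts C"
proof -
  obtain xs where xs: "length xs \<ge> 3" "verts C = set xs"
    "edges C = {{xs ! i, xs ! (Suc i mod length xs)} | i. i < length xs}"
    using assms(1) by (auto simp: is_cycle_def)
  then obtain i where i: "i < length xs" "e = {xs ! i, xs ! (Suc i mod length xs)}"
    using assms(2) by auto
  have "Suc i mod length xs < length xs" using xs(1) by (auto intro: mod_less_divisor)
  then show ?thesis using xs i by auto
qed

lemma cycle_near_perfect_matching:
  assumes "is_cycle C"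
  obtains M where "M \<subseteq> edges C" "pairwise disjnt M" "card M = card (verts C) div 2"
proof -
  obtain xs where xs: "distinct xs" "verts C = set xs"
    "edges C = {{xs ! i, xs ! (Suc i mod length xs)} | i. i < length xs}"
    using assms by (auto simp: is_cycle_def)
  let ?n = "length xs"
  define g where "g i = {xs ! (2 * i), xs ! (Suc (2 * i))}" for i
  have disj: "disjnt (g i) (g j)" if "i < ?n div 2" "j < ?n div 2" "i \<noteq> j" for i j
    using that xs(1) by (auto simp: g_def disjnt_def nth_eq_iff_index_eq)
  have "g i \<in> edges C" if "i < ?n div 2" for i
    using that unfolding xs(3) g_def by (auto intro!: exI[of _ "2 * i"])
  then have "g ` {..<?n div 2} \<subseteq> edges C" by auto
  moreover have "pairwise disjnt (g ` {..<?n div 2})"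
    using disj unfolding pairwise_def by blast
  moreover have "inj_on g {..<?n div 2}"
  proof (rule inj_onI, rule ccontr)
    fix i j assume ij: "i \<in> {..<?n div 2}" "j \<in> {..<?n div 2}" "g i = g j" "i \<noteq> j"
    then have "disjnt (g i) (g i)" using disj[of i j] by auto
    then show False by (auto simp: g_def disjnt_def)
  qed
  then have "card (g ` {..<?n div 2}) = card (verts C) div 2"
    using xs(1,2) by (simp add: card_image distinct_card)
  ultimately show ?thesis using that by blast
qed

section \<open>Graphs with a unique odd cycle\<close>

locale unique_odd_cycle =
  fixes G C :: "'a ugraph"
  assumes simple: "fin_simple_graph G"
    and odd_cycle: "odd_cycle_of G C"
    and unique: "\<And>D. odd_cycle_of G D \<Longrightarrow> D = C"
begin

abbreviation H :: "'a set set" where "H \<equiv> edges G - edges C"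

abbreviation K :: "'a \<Rightarrow> 'a set" where "K \<equiv> component H"

lemma finite_edges: "finite (edges G)"
  using simple finite_imp_finite_nsets finite_subset unfolding fin_simple_graph_def by blast

lemma card_edge: "e \<in> edges G \<Longrightarrow> card e = 2"
  using simple by (auto simp: fin_simple_graph_def nsets_def)

lemma cycle: "is_cycle C" "edges C \<subseteq> edges G" "verts C \<subseteq> verts G" "odd (card (verts C))"
  using odd_cycle by (auto simp: odd_cycle_of_def subgraph_def)

lemma cycle_has_edge: "\<exists>f. f \<in> edges C"
proof -
  obtain xs where xs: "edges C = {{xs ! i, xs ! (Suc i mod length xs)} | i. i < length xs}"
    "length xs \<ge> 3" using cycle(1) by (auto simp: is_cycle_def)
  then have "0 < length xs" by linarith
  then show ?thesis using xs(1) by blast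
qed

lemma finite_if_edges: "M \<subseteq> edges G \<Longrightarrow> finite M"
  using finite_edges by (rule finite_subset[rotated])

lemma finite_cycle: "finite (verts C)"
  using cycle(4) card.infinite by fastforce

lemma subgraph_two_colouring:
  assumes "subgraph F G" "edges F \<subseteq> nsets (verts F) 2" "\<not> subgraph C F"
  obtains c where "proper_colouring c (edges F)"
proof (rule two_colouring)
  show "fin_simple_graph F"
    using assms simple finite_subset by (auto simp: fin_simple_graph_def subgraph_def)
  show "\<not> odd_cycle_of F D" for D
  proof
    assume D: "odd_cycle_of F D"
    then have "odd_cycle_of G D" using assms(1) by (auto simp: odd_cycle_of_def subgraph_def)
    then show False using D unique assms(3) by (auto simp: odd_cycle_of_def)
  qed
qed

lemma colouring_without_cycle_edge:
  assumes "f \<in> edges C"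
  obtains c where "proper_colouring c (edges G - {f})"
proof (rule subgraph_two_colouring[of "\<lparr>verts = verts G, edges = edges G - {f}\<rparr>"])
  fix c assume "proper_colouring c (edges \<lparr>verts = verts G, edges = edges G - {f}\<rparr>)"
  then show thesis using that by simp
qed (use assms simple in \<open>auto simp: subgraph_def fin_simple_graph_def\<close>)

text \<open>If \<open>u\<close> and \<open>v\<close> were joined in \<open>H\<close>, all two-colourings of \<open>H\<close> would agree on whether \<open>u\<close> and \<open>v\<close>
  have the same colour.  But \<open>G\<close> minus an edge of \<open>C\<close> is two-colourable and still contains one of
  the arcs of \<open>C\<close> between \<open>u\<close> and \<open>v\<close>, whose parity decides the question; removing an edge from one
  arc or from the other gives opposite answers.  This avoids building the second odd cycle.\<close>

lemma component_meets_cycle_once: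
  assumes "u \<in> verts C" "v \<in> verts C" "v \<in> K u"
  shows "v = u"
proof (rule ccontr)
  assume "v \<noteq> u"
  obtain xs where xs: "length xs \<ge> 3" "distinct xs" "verts C = set xs"
    "edges C = {{xs ! i, xs ! (Suc i mod length xs)} | i. i < length xs}"
    using cycle(1) by (auto simp: is_cycle_def)
  let ?n = "length xs"
  \<comment> \<open>Indices modulo \<open>n\<close> make the arc through the end of the list the interval from \<open>j\<close> to
    \<open>i + n\<close>.\<close>
  define g where "g k = xs ! (k mod ?n)" for k
  define f where "f k = {g k, g (Suc k)}" for k
  have n: "odd ?n" "?n > 0" using cycle(4) xs by (auto simp: distinct_card)
  have f: "f k = {xs ! (k mod ?n), xs ! (Suc (k mod ?n) mod ?n)}" for k
    by (simp add: f_def g_def mod_Suc_eq)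
  have fC: "f k \<in> edges C" for k using n by (auto simp: f xs(4))
  have f_distinct: "f k \<noteq> f r" if "k mod ?n \<noteq> r mod ?n" for k r
    using cycle_edges_distinct[OF xs(2,1), of "k mod ?n" "r mod ?n"] that n by (auto simp: f)
  have parity: "c (g i) = c (g j) \<longleftrightarrow> even (j - i)"
    if "proper_colouring c (edges G - {f r})" "i \<le> j"
      "\<And>k. i \<le> k \<Longrightarrow> k < j \<Longrightarrow> k mod ?n \<noteq> r mod ?n" for c i j r
    using colour_along_path[OF that(1), of i j g] that(2,3) f_distinct fC cycle(2)
    unfolding f_def by blast
  \<comment> \<open>\<open>f j\<close> lies on the arc from \<open>j\<close> to \<open>i + n\<close>, and \<open>f i\<close> on the arc from \<open>i\<close> to \<open>j\<close>.\<close>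
  have arcs: False if ij: "i < j" "j < ?n" "c (g i) = c (g j) \<longleftrightarrow> d (g i) = d (g j)"
    "proper_colouring c (edges G - {f j})" "proper_colouring d (edges G - {f i})" for i j c d
  proof -
    have "c (g i) = c (g j) \<longleftrightarrow> even (j - i)"
      by (rule parity[OF ij(4)]) (use ij in auto)
    moreover have "d (g j) = d (g (i + ?n)) \<longleftrightarrow> even (i + ?n - j)"
    proof (rule parity[OF ij(5)])
      fix k assume k: "j \<le> k" "k < i + ?n"
      show "k mod ?n \<noteq> i mod ?n"
      proof (cases "k < ?n")
        case False
        then have "k mod ?n = k - ?n" using k ij by (simp add: mod_if)
        then show ?thesis using k ij False by auto
      qed (use k ij in auto)
    qed (use ij in auto)
    moreover have "g (i + ?n) = g i" by (simp add: g_def)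
    moreover have "even (i + ?n - j) \<longleftrightarrow> odd (j - i)"
      using ij(1,2) n(1) by presburger
    ultimately show False using ij(3) by auto
  qed
  obtain i j where ij: "i < ?n" "j < ?n" "u = g i" "v = g j"
    using assms(1,2) xs(3) by (auto simp: in_set_conv_nth g_def)
  obtain c where c: "proper_colouring c (edges G - {f i})"
    using colouring_without_cycle_edge fC by blast
  obtain d where d: "proper_colouring d (edges G - {f j})"
    using colouring_without_cycle_edge fC by blast
  have "proper_colouring c H" "proper_colouring d H"
    using proper_colouring_mono[OF c, of H] proper_colouring_mono[OF d, of H] fC by auto
  then have agree: "c u = c v \<longleftrightarrow> d u = d v"
    by (rule colour_agreement_in_component) (rule assms(3))
  have "i \<noteq> j" using \<open>v \<noteq> u\<close> ij by auto
  then consider "i < j" | "j < i" by linarith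
  then show False
  proof cases
    case 1
    then show False using arcs[of i j d c] c d ij agree by auto
  next
    case 2
    then show False using arcs[of j i c d] c d ij agree by auto
  qed
qed

text \<open>This is the only place where \<open>G\<close> must not be Koenig-Egervary: if all maximum matchings of
  \<open>H[K v]\<close> saturated \<open>v\<close>, a minimum cover of \<open>H[K v]\<close> could be chosen to contain \<open>v\<close>, and would then
  also cover the edges of \<open>C\<close> through which \<open>K v\<close> is attached to the rest of \<open>G\<close>.\<close>

lemma component_matching_missing_attachment:
  assumes nonKE: "\<not> Koenig_Egervary G" and v: "v \<in> verts C"
  obtains N where "N \<subseteq> {e \<in> H. e \<subseteq> K v}" "pairwise disjnt N" "v \<notin> \<Union>N"
    "\<And>L. L \<subseteq> {e \<in> H. e \<subseteq> K v} \<Longrightarrow> pairwise disjnt L \<Longrightarrow> card L \<le> card N"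
proof (rule ccontr)
  assume contra: "\<not> thesis"
  let ?HK = "{e \<in> H. e \<subseteq> K v}"
  let ?A = "{e \<in> ?HK. v \<notin> e}"
  let ?R = "induced G (verts G - K v)"
  have fin: "finite ?HK" "finite ?A" "finite (edges ?R)"
    using finite_edges by (auto simp: induced_def)
  obtain M where M: "M \<subseteq> ?HK" "pairwise disjnt M"
    "\<And>L. L \<subseteq> ?HK \<Longrightarrow> pairwise disjnt L \<Longrightarrow> card L \<le> card M"
    using maximum_matching_exists[OF fin(1)] by blast
  obtain f where f: "f \<in> edges C" using cycle_has_edge by blast
  obtain c where "proper_colouring c (edges G - {f})"
    using colouring_without_cycle_edge[OF f] by blast
  then have "proper_colouring c ?A" using f by (auto intro: proper_colouring_mono)
  then obtain X L where XL: "vertex_cover X ?A" "L \<subseteq> ?A" "pairwise disjnt L" "card X \<le> card L"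
    using koenig[OF fin(2), of c] card_edge by auto
  have L: "L \<subseteq> ?HK" "v \<notin> \<Union>L" using XL(2) by auto
  have "card L \<noteq> card M" using contra that[OF L(1) XL(3) L(2)] M(3) by auto
  then have "card L < card M" using M(3)[OF L(1) XL(3)] by simp
  then have X: "card (insert v X) \<le> card M"
    using XL(4) card_insert_le_m1[of "card M" X v] by simp
  have "\<not> subgraph C ?R"
    using v self_in_component[of v H] by (auto simp: subgraph_def induced_def)
  moreover have "edges ?R \<subseteq> nsets (verts ?R) 2"
    using simple by (auto simp: induced_def fin_simple_graph_def nsets_def)
  ultimately obtain d where "proper_colouring d (edges ?R)"
    using subgraph_two_colouring[of ?R] by (auto simp: subgraph_def induced_def)
  then obtain Y N where YN: "vertex_cover Y (edges ?R)" "N \<subseteq> edges ?R" "pairwise disjnt N"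
    "card Y \<le> card N"
    using koenig[OF fin(3), of d] card_edge by (auto simp: induced_def)
  have "vertex_cover (insert v X \<union> Y) (edges G)"
    unfolding vertex_cover_def
  proof (intro conjI ballI)
    show "finite (insert v X \<union> Y)" using XL(1) YN(1) by (auto simp: vertex_cover_def)
    fix e assume e: "e \<in> edges G"
    show "e \<inter> (insert v X \<union> Y) \<noteq> {}"
    proof (cases "e \<inter> K v = {}")
      case True
      then have "e \<in> edges ?R"
        using e simple by (auto simp: induced_def fin_simple_graph_def nsets_def)
      then show ?thesis using YN(1) by (auto simp: vertex_cover_def)
    next
      case meets: False
      show ?thesis
      proof (cases "e \<in> edges C")
        case True
        then have "v \<in> e"
          using meets component_meets_cycle_once[OF v] cycle_edge_subset[OF cycle(1)] by blast
        then show ?thesis by auto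
      next
        case False
        then have "e \<in> ?HK" using e meets edge_in_component[of e H v] card_edge by auto
        then show ?thesis using XL(1) by (auto simp: vertex_cover_def)
      qed
    qed
  qed
  moreover have apart: "\<Union>M \<inter> \<Union>N = {}" using M(1) YN(2) by (auto simp: induced_def)
  have "matching G (M \<union> N)"
    using M(1) YN(2) pairwise_disjnt_Un[OF M(2) YN(3) apart]
    by (auto simp: matching_def induced_def)
  moreover have "card (insert v X \<union> Y) \<le> card (M \<union> N)"
  proof -
    have "card (M \<union> N) = card M + card N"
      using M(1) YN(2) apart card_edge finite_if_edges
      by (intro card_Un_matchings) (auto simp: induced_def subset_iff)
    then show ?thesis using X YN(4) card_Un_le[of "insert v X" Y] by linarith
  qed
  ultimately show False using koenig_egervary_if_small_cover[OF simple] nonKE by blast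
qed

text \<open>Replacing the part of the matching inside \<open>K v\<close> frees \<open>v\<close> and does not touch any other vertex of
  \<open>C\<close>, so the vertices of \<open>C\<close> can be freed one after another.\<close>

lemma matching_avoiding_cycle:
  assumes nonKE: "\<not> Koenig_Egervary G" and M: "M \<subseteq> H" "pairwise disjnt M"
  obtains M' where "M' \<subseteq> H" "pairwise disjnt M'" "card M \<le> card M'" "\<Union>M' \<inter> verts C = {}"
proof -
  have "\<exists>M'\<subseteq>H. pairwise disjnt M' \<and> card M \<le> card M' \<and> \<Union>M' \<inter> verts C = {}"
    using finite_cycle subset_refl
  proof (induction rule: finite_subset_induct')
    case empty
    show ?case using M by blast
  next
    case (insert v S)
    then obtain L where L: "L \<subseteq> H" "pairwise disjnt L" "card M \<le> card L" "\<Union>L \<inter> S = {}"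
      by blast
    obtain N where N: "N \<subseteq> {e \<in> H. e \<subseteq> K v}" "pairwise disjnt N" "v \<notin> \<Union>N"
      "\<And>L. L \<subseteq> {e \<in> H. e \<subseteq> K v} \<Longrightarrow> pairwise disjnt L \<Longrightarrow> card L \<le> card N"
      using component_matching_missing_attachment[OF nonKE insert.hyps(2)] by blast
    let ?I = "{e \<in> L. e \<subseteq> K v}" and ?O = "{e \<in> L. \<not> e \<subseteq> K v}"
    have fin: "finite L" "finite N" using L(1) N(1) by (auto intro!: finite_if_edges)
    have outside: "e \<inter> K v = {}" if "e \<in> ?O" for e
      using that L(1) edge_in_component[of e H v] card_edge by auto
    then have apart: "\<Union>?O \<inter> \<Union>N = {}" using N(1) by blast
    have pw: "pairwise disjnt ?O" "pairwise disjnt ?I" using L(2) by (auto intro: pairwise_subset)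
    have "card ?I \<le> card N" using N(4)[OF _ pw(2)] L(1) by blast
    moreover have "card L = card ?I + card ?O"
    proof -
      have "L = ?I \<union> ?O" by blast
      moreover have "card (?I \<union> ?O) = card ?I + card ?O"
        using fin(1) by (intro card_Un_disjoint) auto
      ultimately show ?thesis by simp
    qed
    moreover have "card (?O \<union> N) = card ?O + card N"
      using fin L(1) card_edge apart by (intro card_Un_matchings) auto
    ultimately have "card M \<le> card (?O \<union> N)" using L(3) by linarith
    moreover have "pairwise disjnt (?O \<union> N)" by (rule pairwise_disjnt_Un[OF pw(1) N(2) apart])
    moreover have "\<Union>(?O \<union> N) \<inter> insert v S = {}"
    proof -
      have "v \<notin> \<Union>?O" using outside self_in_component[of v H] by blast
      moreover have "K v \<inter> S = {}"
        using component_meets_cycle_once[OF insert.hyps(2)] insert.hyps(3,4) by blast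
      moreover have "\<Union>?O \<subseteq> \<Union>L" "\<Union>N \<subseteq> K v" using N(1) by auto
      ultimately have "\<Union>?O \<inter> insert v S = {}" "\<Union>N \<inter> insert v S = {}"
        using L(4) N(3) by auto
      then show ?thesis by (simp add: Int_Un_distrib2)
    qed
    ultimately show ?case using L(1) N(1) by (intro exI[of _ "?O \<union> N"]) auto
  qed
  then show ?thesis using that by blast
qed

lemma cycle_matching_bound:
  assumes "M \<subseteq> edges G" "\<Union>M \<subseteq> verts C" "pairwise disjnt M"
  shows "card M \<le> card (verts C) div 2"
proof -
  have "2 * card M = card (\<Union>M)"
    using assms card_edge finite_if_edges by (intro card_Union_matching[symmetric]) auto
  also have "\<dots> \<le> card (verts C)" using assms(2) finite_cycle by (rule card_mono[rotated])
  finally show ?thesis by simp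
qed

lemma enlarge_cycle_matching:
  assumes nonKE: "\<not> Koenig_Egervary G"
    and M0: "M\<^sub>0 \<subseteq> edges G" "\<Union>M\<^sub>0 \<subseteq> verts C" "pairwise disjnt M\<^sub>0"
    and M: "matching G M"
  obtains M' where "matching G (M\<^sub>0 \<union> M')" "\<Union>M' \<inter> verts C = {}"
    "card M\<^sub>0 + card (M - edges C) \<le> card (M\<^sub>0 \<union> M')"
proof -
  have "M - edges C \<subseteq> H" "pairwise disjnt (M - edges C)"
    using M by (auto simp: matching_def intro: pairwise_subset)
  then obtain M' where M': "M' \<subseteq> H" "pairwise disjnt M'" "card (M - edges C) \<le> card M'"
    "\<Union>M' \<inter> verts C = {}"
    using matching_avoiding_cycle[OF nonKE] by blast
  have apart: "\<Union>M\<^sub>0 \<inter> \<Union>M' = {}" using M0(2) M'(4) by blast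
  have "matching G (M\<^sub>0 \<union> M')"
    using M0(1) M'(1) pairwise_disjnt_Un[OF M0(3) M'(2) apart] by (auto simp: matching_def)
  moreover have "card (M\<^sub>0 \<union> M') = card M\<^sub>0 + card M'"
    using M0(1) M'(1) card_edge apart by (intro card_Un_matchings finite_if_edges) auto
  ultimately show ?thesis using that M'(3,4) by simp
qed

lemma card_split_cycle:
  assumes "matching G M"
  shows "card M = card (M \<inter> edges C) + card (M - edges C)"
    and "card (M \<inter> edges C) \<le> card (verts C) div 2"
proof -
  have M: "M \<subseteq> edges G" "pairwise disjnt M" using assms by (auto simp: matching_def)
  then have "finite M" using finite_if_edges by blast
  then show "card M = card (M \<inter> edges C) + card (M - edges C)"
    by (metis card_Int_Diff)
  show "card (M \<inter> edges C) \<le> card (verts C) div 2"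
    using M cycle_edge_subset[OF cycle(1)]
    by (intro cycle_matching_bound) (auto intro: pairwise_subset)
qed

theorem maximum_matching_on_cycle:
  assumes nonKE: "\<not> Koenig_Egervary G" and M: "maximum_matching G M"
  shows "card (M \<inter> edges C) = card (verts C) div 2"
proof -
  obtain N where N: "N \<subseteq> edges C" "pairwise disjnt N" "card N = card (verts C) div 2"
    using cycle_near_perfect_matching[OF cycle(1)] by blast
  have mM: "matching G M" and max: "\<And>L. matching G L \<Longrightarrow> card L \<le> card M"
    using M by (auto simp: maximum_matching_iff[OF finite_edges])
  have "N \<subseteq> edges G" "\<Union>N \<subseteq> verts C" using N(1) cycle cycle_edge_subset by blast+
  then obtain L where "matching G (N \<union> L)" "card N + card (M - edges C) \<le> card (N \<union> L)"
    using enlarge_cycle_matching[OF nonKE _ _ N(2) mM] by metis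
  then have "card N + card (M - edges C) \<le> card M" using max le_trans by blast
  then show ?thesis using card_split_cycle[OF mM] N(3) by linarith
qed

theorem maximum_cycle_matching_enlarges:
  assumes nonKE: "\<not> Koenig_Egervary G" and M0: "maximum_matching (induced G (verts C)) M\<^sub>0"
  shows "\<exists>M. maximum_matching G M \<and> M\<^sub>0 \<subseteq> M \<and> (\<exists>!v. v \<in> verts C \<and> \<not> saturates M v)"
proof -
  have fin: "finite (edges (induced G (verts C)))" using finite_edges by (simp add: induced_def)
  have m0: "M\<^sub>0 \<subseteq> edges G" "\<Union>M\<^sub>0 \<subseteq> verts C" "pairwise disjnt M\<^sub>0"
    and max0: "\<And>L. matching (induced G (verts C)) L \<Longrightarrow> card L \<le> card M\<^sub>0"
    using M0 unfolding maximum_matching_iff[OF fin] by (auto simp: matching_def induced_def)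
  obtain N where N: "N \<subseteq> edges C" "pairwise disjnt N" "card N = card (verts C) div 2"
    using cycle_near_perfect_matching[OF cycle(1)] by blast
  have "matching (induced G (verts C)) N"
    using N(1,2) cycle(2) cycle_edge_subset[OF cycle(1)]
    by (auto simp: matching_def induced_def)
  then have card0: "card M\<^sub>0 = card (verts C) div 2"
    using max0[of N] N(3) cycle_matching_bound[OF m0] by simp
  obtain M where M: "M \<subseteq> edges G" "pairwise disjnt M"
    "\<And>L. L \<subseteq> edges G \<Longrightarrow> pairwise disjnt L \<Longrightarrow> card L \<le> card M"
    using maximum_matching_exists[OF finite_edges] by blast
  then have mM: "matching G M" by (simp add: matching_def)
  obtain M' where M': "matching G (M\<^sub>0 \<union> M')" "\<Union>M' \<inter> verts C = {}"
    "card M\<^sub>0 + card (M - edges C) \<le> card (M\<^sub>0 \<union> M')"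
    using enlarge_cycle_matching[OF nonKE m0 mM] by metis
  have "card M \<le> card (M\<^sub>0 \<union> M')" using card_split_cycle[OF mM] card0 M'(3) by linarith
  then have "maximum_matching G (M\<^sub>0 \<union> M')"
    using M'(1) M(3) unfolding maximum_matching_iff[OF finite_edges]
    by (auto simp: matching_def intro: le_trans)
  moreover have "\<exists>!v. v \<in> verts C \<and> \<not> saturates (M\<^sub>0 \<union> M') v"
  proof -
    have "card (\<Union>M\<^sub>0) = 2 * card M\<^sub>0"
      using m0 card_edge finite_if_edges by (intro card_Union_matching) auto
    moreover have "card (verts C) = 2 * card M\<^sub>0 + 1"
      using card0 cycle(4) by (metis odd_two_times_div_two_succ)
    moreover have "card (verts C - \<Union>M\<^sub>0) = card (verts C) - card (\<Union>M\<^sub>0)"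
      using m0(2) finite_cycle by (intro card_Diff_subset) (auto intro: finite_subset)
    ultimately have "card (verts C - \<Union>M\<^sub>0) = 1" by simp
    then obtain v where v: "verts C - \<Union>M\<^sub>0 = {v}" by (auto simp: card_1_singleton_iff)
    have "saturates (M\<^sub>0 \<union> M') w \<longleftrightarrow> w \<in> \<Union>M\<^sub>0" if "w \<in> verts C" for w
      using that M'(2) by (auto simp: saturates_def)
    then have free: "w \<in> verts C \<and> \<not> saturates (M\<^sub>0 \<union> M') w \<longleftrightarrow> w \<in> verts C - \<Union>M\<^sub>0" for w
      by blast
    show ?thesis unfolding free v by simp
  qed
  ultimately show ?thesis by (intro exI[of _ "M\<^sub>0 \<union> M'"]) simp
qed

end

theorem theorem2p14:
  fixes G C :: "'a ugraph"
  assumes "fin_simple_graph G"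
    and "almost_bipartite G"
    and "\<not> Koenig_Egervary G"
    and "odd_cycle_of G C"
  shows "(\<forall>M. maximum_matching G M \<longrightarrow> card (M \<inter> edges C) = card (verts C) div 2) \<and>
    (\<forall>M\<^sub>0. maximum_matching (induced G (verts C)) M\<^sub>0 \<longrightarrow>
      (\<exists>M. maximum_matching G M \<and> M\<^sub>0 \<subseteq> M \<and>
        (\<exists>!v. v \<in> verts C \<and> \<not> saturates M v)))"
proof -
  interpret unique_odd_cycle G C
  proof
    show "fin_simple_graph G" "odd_cycle_of G C" by (rule assms)+
    show "D = C" if "odd_cycle_of G D" for D
      using assms(2,4) that unfolding almost_bipartite_def by blast
  qed
  show ?thesis
    using maximum_matching_on_cycle[OF assms(3)] maximum_cycle_matching_enlarges[OF assms(3)]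
    by (intro conjI allI impI)
qed

end
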